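(* Let $G$ be the graph with vertex set $\{1,2,\dots,10\}$ and edges $\{1,2\},\{1,3\},\{1,4\},\{1,5\},\{2,3\},\{2,4\},\{3,4\},\{3,6\},\{5,7\},\{5,8\},\{7,8\},\{6,9\},\{6,10\},\{9,10\}$. Then $c_2=\frac17$, and $$\vec\phi=\tfrac1{28}(-1,-1,-1,-1,1,1,1,1,1,1)$$ is an eigenvector of the $1$-Laplacian of $G$ with eigenvalue $c_2$ which has $W(\vec\phi)=3$ weak nodal domains. In particular, the bound $W(\vec\phi_k)\le k$ for eigenvectors $\vec\phi_k$ with eigenvalue $c_k$ fails in general for the graph $1$-Laplacian.
   Context: For a finite simple connected graph $G=(V,E)$, $V=\{1,\dots,n\}$, with degrees $d_i$: $\mathrm{Sgn}(t)=\{1\}$ if $t>0$, $\{-1\}$ if $t<0$, $[-1,1]$ if $t=0$; $I(\vec x)=\sum_{\{i,j\}\in E}|x_i-x_j|$; $X=\{\vec x\in\mathbb R^n:\sum_i d_i|x_i|=1\}$. A nonzero $\vec x\in\mathbb R^n$ is an eigenvector of the $1$-Laplacian with eigenvalue $\mu$ if there exist $z_{ij}\in\mathrm{Sgn}(x_i-x_j)$ with $z_{ji}=-z_{ij}$ (for all adjacent $i,j$) such that $\sum_{j\sim i}z_{ij}\in\mu d_i\,\mathrm{Sgn}(x_i)$ for all $i\in V$. $c_k=\inf_{\gamma(A)\ge k}\max_{\vec x\in A}I(\vec x)$, the infimum over closed sets $A=-A\subset X$, where $\gamma(A)$ is the Krasnoselskii genus: the least integer $m\ge0$ for which there is an odd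 continuous map $A\to\mathbb R^m\setminus\{0\}$. It is known that $c_2$ equals the Cheeger constant $h(G)=\min_{\emptyset\ne S\subsetneq V}\frac{|E(S,S^c)|}{\min\{\mathrm{vol}(S),\mathrm{vol}(S^c)\}}$, where $\mathrm{vol}(S)=\sum_{i\in S}d_i$ and $E(S,S^c)$ is the set of edges between $S$ and $S^c$. A positive (negative) weak nodal domain of $\vec x$ is a connected component of the subgraph induced on $\{i:x_i\ge0\}$ ($\{i:x_i\le0\}$) that contains at least one vertex with $x_j>0$ ($x_j<0$); $W(\vec x)$ is the total number of weak nodal domains. *)

theory Defs
  imports "HOL-Analysis.Analysis"
begin

text \<open>
  A graph on the vertex set \<open>{1..n}\<close> is given by \<open>n\<close> and its set \<open>E\<close> of two-element edges
  \<open>{i, j}\<close>.  The space \<open>\<real>\<^sup>n\<close> is the set of functions on \<open>nat\<close> that vanish outside \<open>{1..n}\<close>,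
  so that \<open>n\<close> is a term and can be quantified over.  The library's product topology on
  \<^typ>\<open>nat \<Rightarrow> real\<close> induces the usual topology on this (closed) subspace.
\<close>

definition Rvec :: "nat \<Rightarrow> (nat \<Rightarrow> real) set" where
  "Rvec n = {x. \<forall>i. i \<notin> {1..n} \<longrightarrow> x i = 0}"

definition adj_on :: "nat set set \<Rightarrow> nat set \<Rightarrow> (nat \<times> nat) set" where
  "adj_on E U = {(i, j). i \<in> U \<and> j \<in> U \<and> {i, j} \<in> E}"

definition connected_simple_graph :: "nat \<Rightarrow> nat set set \<Rightarrow> bool" where
  "connected_simple_graph n E \<longleftrightarrow>
     n \<ge> 1 \<and>
     E \<subseteq> {e. e \<subseteq> {1..n} \<and> card e = 2} \<and>
     (\<forall>i\<in>{1..n}. \<forall>j\<in>{1..n}. (i, j) \<in> (adj_on E {1..n})\<^sup>*)"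

definition nbrs :: "nat set set \<Rightarrow> nat \<Rightarrow> nat set" where
  "nbrs E i = {j. {i, j} \<in> E}"

definition deg :: "nat set set \<Rightarrow> nat \<Rightarrow> nat" where
  "deg E i = card (nbrs E i)"

definition Sgn :: "real \<Rightarrow> real set" where
  "Sgn t = (if t > 0 then {1} else if t < 0 then {-1} else {-1..1})"

text \<open>Each edge \<open>{i, j}\<close> is counted once, through its ordering \<open>i < j\<close>.\<close>

definition total_variation :: "nat set set \<Rightarrow> (nat \<Rightarrow> real) \<Rightarrow> real" where
  "total_variation E x = (\<Sum>(i, j)\<in>{(i, j). i < j \<and> {i, j} \<in> E}. \<bar>x i - x j\<bar>)"

definition Xset :: "nat \<Rightarrow> nat set set \<Rightarrow> (nat \<Rightarrow> real) set" where
  "Xset n E = {x \<in> Rvec n. (\<Sum>i=1..n. real (deg E i) * \<bar>x i\<bar>) = 1}"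

definition eigenvector1 :: "nat \<Rightarrow> nat set set \<Rightarrow> real \<Rightarrow> (nat \<Rightarrow> real) \<Rightarrow> bool" where
  "eigenvector1 n E \<mu> x \<longleftrightarrow>
     x \<in> Rvec n \<and> x \<noteq> (\<lambda>i. 0) \<and>
     (\<exists>z :: nat \<Rightarrow> nat \<Rightarrow> real.
        (\<forall>i j. {i, j} \<in> E \<longrightarrow> z i j \<in> Sgn (x i - x j) \<and> z j i = - z i j) \<and>
        (\<forall>i\<in>{1..n}. (\<Sum>j\<in>nbrs E i. z i j) \<in> (\<lambda>s. \<mu> * real (deg E i) * s) ` Sgn (x i)))"

text \<open>
  If \<open>A \<subseteq> Rvec n\<close> does not contain \<open>0\<close>, the identity shows that some such \<open>m\<close> exists, so the
  \<^term>\<open>Least\<close> is well defined; the genus is used only for such \<open>A\<close>.  Negation of vectors is the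
  library's pointwise \<^term>\<open>uminus\<close> on functions.
\<close>

definition genus :: "(nat \<Rightarrow> real) set \<Rightarrow> nat" where
  "genus A = (LEAST m. \<exists>f :: (nat \<Rightarrow> real) \<Rightarrow> nat \<Rightarrow> real.
     continuous_on A f \<and> f ` A \<subseteq> Rvec m - {\<lambda>i. 0} \<and> (\<forall>x\<in>A. f (- x) = - f x))"

text \<open>
  For \<open>k \<ge> 1\<close> every admissible \<open>A\<close> is nonempty and compact (if no vertex is isolated), so the
  supremum is a maximum.  Admissible sets exist for \<open>k \<le> n\<close>; for \<open>k > n\<close> the infimum is over
  the empty set and the value carries no meaning.
\<close>

definition minimax :: "nat \<Rightarrow> nat set set \<Rightarrow> nat \<Rightarrow> real" where
  "minimax n E k =
     Inf {SUP x\<in>A. total_variation E x | A.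
            closed A \<and> uminus ` A = A \<and> A \<subseteq> Xset n E \<and> genus A \<ge> k}"

definition graph_components :: "nat set set \<Rightarrow> nat set \<Rightarrow> nat set set" where
  "graph_components E U = U // (adj_on E U)\<^sup>*"

definition pos_weak_domains :: "nat \<Rightarrow> nat set set \<Rightarrow> (nat \<Rightarrow> real) \<Rightarrow> nat set set" where
  "pos_weak_domains n E x =
     {C \<in> graph_components E {i \<in> {1..n}. x i \<ge> 0}. \<exists>j\<in>C. x j > 0}"

definition neg_weak_domains :: "nat \<Rightarrow> nat set set \<Rightarrow> (nat \<Rightarrow> real) \<Rightarrow> nat set set" where
  "neg_weak_domains n E x =
     {C \<in> graph_components E {i \<in> {1..n}. x i \<le> 0}. \<exists>j\<in>C. x j < 0}"

definition W :: "nat \<Rightarrow> nat set set \<Rightarrow> (nat \<Rightarrow> real) \<Rightarrow> nat" where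
  "W n E x = card (pos_weak_domains n E x) + card (neg_weak_domains n E x)"

end

theory Submission
  imports Defs
begin

text \<open>
  Lower bound for \<open>c\<^sub>2\<close>: if \<open>x\<^sub>1 = 0\<close>, then \<open>I(x) \<ge> 1/7\<close> on \<open>X\<close>, because a flow with edge capacities
  \<open>1\<close> can send \<open>d\<^sub>i/7\<close> from vertex \<open>1\<close> to every other vertex \<open>i\<close>.  So a symmetric set on which
  \<open>I < 1/7\<close> is mapped by the odd function \<open>x\<^sub>1\<close> into the nonzero reals and has genus at most \<open>1\<close>.
  Upper bound: on the \<open>\<ell>\<^sup>1\<close>-circle of vectors constant on \<open>{1..4}\<close> and on \<open>{5..10}\<close> one has
  \<open>I = 2\<bar>a - b\<bar> \<le> 2(\<bar>a\<bar> + \<bar>b\<bar>) = 1/7\<close>, and by the intermediate value theorem its genus is at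
  least \<open>2\<close>.
\<close>

section \<open>Bounds on the genus\<close>

lemma Rvec_1_nonzero:
  assumes "y \<in> Rvec 1 - {\<lambda>i. 0}"
  shows "y 1 \<noteq> 0"
proof
  assume "y 1 = 0"
  moreover have "y i = 0" if "i \<noteq> 1" for i
    using assms that by (simp add: Rvec_def)
  ultimately have "y = (\<lambda>i. 0)"
    by metis
  then show False
    using assms by blast
qed

lemma genus_le_1:
  assumes "\<forall>x\<in>A. x k \<noteq> 0"
  shows "genus A \<le> 1"
proof -
  define f where "f x i = (if i = 1 then x k else 0)" for x :: "nat \<Rightarrow> real" and i :: nat
  have "continuous_on A (\<lambda>x. f x i)" for i
  proof (cases "i = 1")
    case True
    have "continuous_on A (\<lambda>x. x k)"
      using continuous_on_product_coordinates by (rule continuous_on_subset) simp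
    with True show ?thesis by (simp add: f_def)
  qed (simp add: f_def)
  then have "continuous_on A f"
    by (rule continuous_on_coordinatewise_then_product)
  moreover have "f ` A \<subseteq> Rvec 1 - {\<lambda>i. 0}"
  proof (rule image_subsetI)
    fix x assume "x \<in> A"
    with assms have "f x 1 \<noteq> 0"
      by (simp add: f_def)
    then have "f x \<noteq> (\<lambda>i. 0)"
      by auto
    then show "f x \<in> Rvec 1 - {\<lambda>i. 0}"
      by (simp add: Rvec_def f_def)
  qed
  moreover have "\<forall>x\<in>A. f (- x) = - f x"
    by (simp add: fun_eq_iff f_def)
  ultimately show ?thesis
    unfolding genus_def by (intro Least_le exI[of _ f] conjI)
qed

text \<open>The path \<open>p\<close> joins a point of \<open>A\<close> to its antipode. An odd map
  into \<open>Rvec 1\<close> takes opposite values at the two ends, so it vanishes somewhere along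
  \<open>p\<close>.\<close>

lemma genus_ge_2:
  fixes p :: "real \<Rightarrow> nat \<Rightarrow> real"
  assumes A: "A \<subseteq> Rvec n - {\<lambda>i. 0}"
    and p: "continuous_on {-1..1} p" "p ` {-1..1} \<subseteq> A" "p (-1) = - p 1"
  shows "genus A \<ge> 2"
proof -
  let ?P = "\<lambda>m. \<exists>f :: (nat \<Rightarrow> real) \<Rightarrow> nat \<Rightarrow> real.
     continuous_on A f \<and> f ` A \<subseteq> Rvec m - {\<lambda>i. 0} \<and> (\<forall>x\<in>A. f (- x) = - f x)"
  \<comment> \<open>The identity is admissible because \<open>A\<close> avoids 0, so the
    \<open>LEAST\<close> is attained by an actual odd map.\<close>
  have "?P n"
    using A by (intro exI[of _ "\<lambda>x. x"]) auto
  then have "?P (genus A)"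
    unfolding genus_def by (rule LeastI)
  then obtain f where f: "continuous_on A f" "f ` A \<subseteq> Rvec (genus A) - {\<lambda>i. 0}"
      "\<And>x. x \<in> A \<Longrightarrow> f (- x) = - f x"
    by blast
  have p1: "p 1 \<in> A"
    using p(2) by auto
  \<comment> \<open>\<open>Rvec 0\<close> is the origin alone, so genus 0 would force
    \<open>A\<close> to be empty.\<close>
  have "genus A \<noteq> 0"
    using f(2) p1 by (force simp: Rvec_def fun_eq_iff)
  moreover have "genus A \<noteq> 1"
  proof
    assume g: "genus A = 1"
    define h where "h t = f (p t) 1" for t
    have nz: "h t \<noteq> 0" if "t \<in> {-1..1}" for t
      unfolding h_def
    proof (rule Rvec_1_nonzero)
      show "f (p t) \<in> Rvec 1 - {\<lambda>i. 0}"
        using f(2)[unfolded g] p(2) that by blast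
    qed
    have "continuous_on {-1..1} (\<lambda>t. f (p t))"
      using continuous_on_compose2[OF f(1) p(1,2)] .
    then have cont: "continuous_on {-1..1} h"
      unfolding h_def by (rule continuous_on_product_then_coordinatewise)
    have odd: "h (-1) = - h 1"
      using f(3)[OF p1] p(3) by (simp add: h_def)
    have "\<exists>t\<ge>-1. t \<le> 1 \<and> h t = 0"
    proof (cases "h 1 \<ge> 0")
      case True
      with odd cont show ?thesis by (intro IVT') auto
    next
      case False
      with odd cont show ?thesis by (intro IVT2') auto
    qed
    with nz show False by auto
  qed
  ultimately show ?thesis by linarith
qed

section \<open>Components of a symmetric relation\<close>

text \<open>Here \<open>c\<close> serves as a root: by symmetry each point of \<open>C\<close>
  reaches \<open>c\<close> and from there all of \<open>C\<close>, while closure under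
  \<open>r\<close> prevents leaving \<open>C\<close>. Paths from one vertex thus certify a
  component.\<close>

lemma rtrancl_Image_eq:
  assumes "sym r" "r `` C \<subseteq> C" "\<And>j. j \<in> C \<Longrightarrow> (c, j) \<in> r\<^sup>*" "i \<in> C"
  shows "r\<^sup>* `` {i} = C"
proof
  have "r\<^sup>* `` C = C"
    using assms(2) by (rule Image_closed_trancl)
  then show "r\<^sup>* `` {i} \<subseteq> C"
    using assms(4) by blast
  show "C \<subseteq> r\<^sup>* `` {i}"
  proof
    fix j assume "j \<in> C"
    moreover have "(i, c) \<in> r\<^sup>*"
      using assms(3)[OF assms(4)] sym_rtrancl[OF assms(1)] by (meson symD)
    ultimately show "j \<in> r\<^sup>* `` {i}"
      using assms(3) by (auto intro: rtrancl_trans)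
  qed
qed

lemma adj_on_iff_nbrs: "(i, j) \<in> adj_on E U \<longleftrightarrow> i \<in> U \<and> j \<in> U \<and> j \<in> nbrs E i"
  by (simp add: adj_on_def nbrs_def)

lemma sym_adj_on: "sym (adj_on E U)"
  by (auto simp: sym_def adj_on_def insert_commute)

section \<open>The graph and its explicit sums\<close>

definition G10 :: "nat set set" where
  "G10 = {{1,2}, {1,3}, {1,4}, {1,5}, {2,3}, {2,4}, {3,4}, {3,6}, {5,7}, {5,8},
          {7,8}, {6,9}, {6,10}, {9,10}}"

lemma atLeastAtMost_1_10: "{1..10::nat} = {1,2,3,4,5,6,7,8,9,10}"
  by (simp add: atLeastAtMost_upt upt_rec eval_nat_numeral)

lemma G10_iff:
  "{i, j} \<in> G10 \<longleftrightarrow> (i, j) \<in>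
     {(1,2), (2,1), (1,3), (3,1), (1,4), (4,1), (1,5), (5,1), (2,3), (3,2), (2,4), (4,2), (3,4), (4,3),
      (3,6), (6,3), (5,7), (7,5), (5,8), (8,5), (7,8), (8,7), (6,9), (9,6), (6,10), (10,6), (9,10), (10,9)}"
  unfolding G10_def by (simp only: doubleton_eq_iff insert_iff empty_iff prod.inject simp_thms disj_assoc)

lemma nbrs_G10:
  "nbrs G10 1 = {2,3,4,5}" "nbrs G10 2 = {1,3,4}" "nbrs G10 3 = {1,2,4,6}" "nbrs G10 4 = {1,2,3}"
  "nbrs G10 5 = {1,7,8}" "nbrs G10 6 = {3,9,10}" "nbrs G10 7 = {5,8}" "nbrs G10 8 = {5,7}"
  "nbrs G10 9 = {6,10}" "nbrs G10 10 = {6,9}"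
  by (rule set_eqI, simp add: nbrs_def G10_iff)+

lemma weighted_sum_G10:
  "(\<Sum>i=1..10. real (deg G10 i) * g i) =
     4 * g 1 + 3 * g 2 + 4 * g 3 + 3 * g 4 + 3 * g 5 + 3 * g 6 + 2 * g 7 + 2 * g 8 + 2 * g 9 + 2 * g 10"
  unfolding atLeastAtMost_1_10 deg_def by (simp add: nbrs_G10[simplified])

lemma total_variation_G10:
  "total_variation G10 x =
     \<bar>x 1 - x 2\<bar> + \<bar>x 1 - x 3\<bar> + \<bar>x 1 - x 4\<bar> + \<bar>x 1 - x 5\<bar> + \<bar>x 2 - x 3\<bar> + \<bar>x 2 - x 4\<bar> + \<bar>x 3 - x 4\<bar>
     + \<bar>x 3 - x 6\<bar> + \<bar>x 5 - x 7\<bar> + \<bar>x 5 - x 8\<bar> + \<bar>x 7 - x 8\<bar> + \<bar>x 6 - x 9\<bar> + \<bar>x 6 - x 10\<bar> + \<bar>x 9 - x 10\<bar>"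
proof -
  have *: "{(i, j). i < j \<and> {i, j} \<in> G10} =
      {(1,2), (1,3), (1,4), (1,5), (2,3), (2,4), (3,4), (3,6), (5,7), (5,8), (7,8), (6,9), (6,10), (9,10)}" (is "?L = ?R")
  proof
    show "?L \<subseteq> ?R"
    proof (rule subrelI)
      fix i j assume "(i, j) \<in> ?L"
      then have "{i, j} \<in> G10" "i < j"
        by simp_all
      then show "(i, j) \<in> ?R"
        unfolding G10_iff by (elim insertE emptyE; simp)
    qed
    show "?R \<subseteq> ?L"
      by (simp add: G10_iff)
  qed
  show ?thesis
    unfolding total_variation_def * by simp
qed

lemma Xset_G10:
  "x \<in> Xset 10 G10 \<longleftrightarrow> x \<in> Rvec 10 \<and>
     4 * \<bar>x 1\<bar> + 3 * \<bar>x 2\<bar> + 4 * \<bar>x 3\<bar> + 3 * \<bar>x 4\<bar> + 3 * \<bar>x 5\<bar> + 3 * \<bar>x 6\<bar> + 2 * \<bar>x 7\<bar> + 2 * \<bar>x 8\<bar>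
     + 2 * \<bar>x 9\<bar> + 2 * \<bar>x 10\<bar> = 1"
  unfolding Xset_def mem_Collect_eq weighted_sum_G10 ..

section \<open>Lower bound for the minimax value\<close>

text \<open>Each vertex lies on as many edges as its degree, so summing the triangle inequality over
  the edges gives the weighted norm. This bound makes the real suprema over admissible sets
  meaningful.\<close>

lemma total_variation_G10_le_1:
  assumes "x \<in> Xset 10 G10"
  shows "total_variation G10 x \<le> 1"
proof -
  define d where "d i j = \<bar>x i - x j\<bar>" for i j
  define y where "y i = \<bar>x i\<bar>" for i
  have d: "d i j \<le> y i + y j" for i j
    unfolding d_def y_def by (rule abs_triangle_ineq4)
  have "4 * y 1 + 3 * y 2 + 4 * y 3 + 3 * y 4 + 3 * y 5 + 3 * y 6 + 2 * y 7 + 2 * y 8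
      + 2 * y 9 + 2 * y 10 = 1"
    using assms unfolding Xset_G10 y_def by blast
  then have "d 1 2 + d 1 3 + d 1 4 + d 1 5 + d 2 3 + d 2 4 + d 3 4 + d 3 6
      + d 5 7 + d 5 8 + d 7 8 + d 6 9 + d 6 10 + d 9 10 \<le> 1"
    using d[of 1 2] d[of 1 3] d[of 1 4] d[of 1 5] d[of 2 3] d[of 2 4] d[of 3 4]
      d[of 3 6] d[of 5 7] d[of 5 8] d[of 7 8] d[of 6 9] d[of 6 10] d[of 9 10]
    by linarith
  then show ?thesis
    unfolding total_variation_G10 d_def .
qed

text \<open>
  The flow out of vertex \<open>1\<close>, in units of \<open>1/7\<close>: \<open>5\<close> along \<open>12\<close> and \<open>14\<close>, \<open>7\<close> along \<open>13\<close>, \<open>15\<close>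
  and \<open>36\<close>, and \<open>2\<close> along \<open>23\<close>, \<open>43\<close>, \<open>57\<close>, \<open>58\<close>, \<open>69\<close> and \<open>6 10\<close>.
\<close>

lemma total_variation_G10_ge:
  assumes "x \<in> Xset 10 G10" "x 1 = 0"
  shows "total_variation G10 x \<ge> 1/7"
proof -
  define d where "d i j = \<bar>x i - x j\<bar>" for i j
  define y where "y i = \<bar>x i\<bar>" for i
  have flow: "k * (y j - y i) \<le> 7 * d i j" if "\<bar>k\<bar> \<le> 7" for k i j
  proof -
    have "k * (y j - y i) \<le> \<bar>k\<bar> * \<bar>y j - y i\<bar>"
      by (metis abs_ge_self abs_mult)
    also have "\<bar>y j - y i\<bar> \<le> d i j"
      unfolding d_def y_def by linarith
    then have "\<bar>k\<bar> * \<bar>y j - y i\<bar> \<le> 7 * d i j"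
      using that by (intro mult_mono) auto
    finally show ?thesis .
  qed
  have "y 1 = 0"
    using assms(2) by (simp only: y_def abs_zero)
  moreover have "4 * y 1 + 3 * y 2 + 4 * y 3 + 3 * y 4 + 3 * y 5 + 3 * y 6 + 2 * y 7 + 2 * y 8
      + 2 * y 9 + 2 * y 10 = 1"
    using assms unfolding Xset_G10 y_def by blast
  \<comment> \<open>Summation by parts: the net inflow at each vertex \<open>j\<close> other than 1
    is its degree, and \<open>y 1 = 0\<close>. The coefficient -2 is the flow from 4 to 3, written
    against the orientation of the edge.\<close>
  ultimately have "1 = 5 * (y 2 - y 1) + 7 * (y 3 - y 1) + 5 * (y 4 - y 1) + 7 * (y 5 - y 1)
      + 2 * (y 3 - y 2) + 0 * (y 4 - y 2) + (- 2) * (y 4 - y 3) + 7 * (y 6 - y 3) + 2 * (y 7 - y 5)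
      + 2 * (y 8 - y 5) + 0 * (y 8 - y 7) + 2 * (y 9 - y 6) + 2 * (y 10 - y 6) + 0 * (y 10 - y 9)"
    by (simp add: algebra_simps)
  also have "\<dots> \<le> 7 * d 1 2 + 7 * d 1 3 + 7 * d 1 4 + 7 * d 1 5 + 7 * d 2 3 + 7 * d 2 4 + 7 * d 3 4
      + 7 * d 3 6 + 7 * d 5 7 + 7 * d 5 8 + 7 * d 7 8 + 7 * d 6 9 + 7 * d 6 10 + 7 * d 9 10"
    by (intro add_mono flow) simp_all
  finally have "1/7 \<le> d 1 2 + d 1 3 + d 1 4 + d 1 5 + d 2 3 + d 2 4 + d 3 4 + d 3 6
      + d 5 7 + d 5 8 + d 7 8 + d 6 9 + d 6 10 + d 9 10"
    by simp
  then show ?thesis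
    unfolding total_variation_G10 d_def .
qed

lemma SUP_total_variation_G10_ge:
  assumes "A \<subseteq> Xset 10 G10" "genus A \<ge> 2"
  shows "(SUP x\<in>A. total_variation G10 x) \<ge> 1/7"
proof -
  have "\<not> (\<forall>x\<in>A. x 1 \<noteq> 0)"
    using genus_le_1[of A 1] assms(2) by linarith
  then obtain x where x: "x \<in> A" "x 1 = 0"
    by blast
  have "bdd_above (total_variation G10 ` A)"
    using assms(1) total_variation_G10_le_1 by (intro bdd_aboveI[of _ 1]) auto
  then have "total_variation G10 x \<le> (SUP x\<in>A. total_variation G10 x)"
    using x(1) by (intro cSUP_upper)
  then show ?thesis
    using total_variation_G10_ge[of x] x assms(1) by force
qed

section \<open>Upper bound from a symmetric circle\<close>

text \<open>Both blocks have volume 14, so with \<open>a = x 1\<close> and \<open>b = x 5\<close>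
  the normalisation reads \<open>14 * (\<bar>a\<bar> + \<bar>b\<bar>) = 1\<close>.\<close>

definition two_valued :: "(nat \<Rightarrow> real) set" where
  "two_valued = {x. x \<in> Xset 10 G10 \<and> x 2 = x 1 \<and> x 3 = x 1 \<and> x 4 = x 1 \<and>
     x 6 = x 5 \<and> x 7 = x 5 \<and> x 8 = x 5 \<and> x 9 = x 5 \<and> x 10 = x 5}"

lemma closed_two_valued: "closed two_valued"
proof -
  have eq: "two_valued = {x. (\<forall>i. i \<notin> {1..10} \<longrightarrow> x i = 0) \<and>
     4 * \<bar>x 1\<bar> + 3 * \<bar>x 2\<bar> + 4 * \<bar>x 3\<bar> + 3 * \<bar>x 4\<bar> + 3 * \<bar>x 5\<bar> + 3 * \<bar>x 6\<bar> + 2 * \<bar>x 7\<bar> + 2 * \<bar>x 8\<bar>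
     + 2 * \<bar>x 9\<bar> + 2 * \<bar>x 10\<bar> = 1 \<and>
     x 2 = x 1 \<and> x 3 = x 1 \<and> x 4 = x 1 \<and>
     x 6 = x 5 \<and> x 7 = x 5 \<and> x 8 = x 5 \<and> x 9 = x 5 \<and> x 10 = x 5}"
    unfolding two_valued_def Xset_G10 Rvec_def by blast
  show ?thesis
    unfolding eq
    by (intro closed_Collect_conj closed_Collect_all closed_Collect_imp closed_Collect_eq
        open_Collect_const continuous_intros continuous_on_product_coordinates)
qed

lemma uminus_two_valued: "uminus ` two_valued = two_valued"
proof -
  have "- x \<in> two_valued" if "x \<in> two_valued" for x
    using that by (auto simp: two_valued_def Xset_G10 Rvec_def)
  then show ?thesis
    by (force simp: image_iff)
qed

lemma genus_two_valued: "genus two_valued \<ge> 2"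
proof (rule genus_ge_2)
  show "two_valued \<subseteq> Rvec 10 - {\<lambda>i. 0}"
    by (auto simp: two_valued_def Xset_G10)
  \<comment> \<open>Half of the circle, with second value nonnegative, from
    \<open>(-1/14, 0)\<close> through \<open>(0, 1/14)\<close> to \<open>(1/14, 0)\<close>.\<close>
  define p :: "real \<Rightarrow> nat \<Rightarrow> real" where
    "p t = (\<lambda>i. if i \<in> {1..4} then t/14 else if i \<in> {5..10} then (1 - \<bar>t\<bar>)/14 else 0)" for t
  have "continuous_on {-1..1} (\<lambda>t. p t i)" for i
    unfolding p_def by (cases "i \<in> {1..4}"; cases "i \<in> {5..10}")
      (simp_all only: if_True if_False, (intro continuous_intros; simp)+)
  then show "continuous_on {-1..1} p"
    by (rule continuous_on_coordinatewise_then_product)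
  show "p ` {-1..1} \<subseteq> two_valued"
    by (auto simp: two_valued_def Xset_G10 Rvec_def p_def)
  show "p (-1) = - p 1"
    by (auto simp: p_def)
qed

text \<open>Only the edges {1,5} and {3,6} join the two blocks; all others contribute 0.\<close>

lemma total_variation_two_valued:
  assumes "x \<in> two_valued"
  shows "total_variation G10 x \<le> 1/7"
  using assms abs_triangle_ineq4[of "x 1" "x 5"]
  by (auto simp: two_valued_def Xset_G10 total_variation_G10)

lemma minimax_G10: "minimax 10 G10 2 = 1/7"
  unfolding minimax_def
proof (rule cInf_eq_minimum)
  have sub: "two_valued \<subseteq> Xset 10 G10"
    by (auto simp: two_valued_def)
  \<comment> \<open>The empty set has genus at most 1.\<close>
  have "two_valued \<noteq> {}"
    using genus_two_valued genus_le_1[of "{}"] by auto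
  then have "(SUP x\<in>two_valued. total_variation G10 x) \<le> 1/7"
    by (intro cSUP_least total_variation_two_valued)
  then have "1/7 = (SUP x\<in>two_valued. total_variation G10 x)"
    using SUP_total_variation_G10_ge[OF sub genus_two_valued] by linarith
  then show "1/7 \<in> {SUP x\<in>A. total_variation G10 x | A.
      closed A \<and> uminus ` A = A \<and> A \<subseteq> Xset 10 G10 \<and> 2 \<le> genus A}"
    using sub closed_two_valued uminus_two_valued genus_two_valued by blast
qed (use SUP_total_variation_G10_ge in blast)

section \<open>Connectivity, the eigenvector and its nodal domains\<close>

lemma connected_G10: "connected_simple_graph 10 G10"
proof -
  let ?r = "adj_on G10 {1..10}"
  \<comment> \<open>These nine edges form a spanning tree rooted at 1.\<close>
  have edges: "(1,2) \<in> ?r" "(1,3) \<in> ?r" "(1,4) \<in> ?r" "(1,5) \<in> ?r" "(3,6) \<in> ?r" "(5,7) \<in> ?r"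
      "(5,8) \<in> ?r" "(6,9) \<in> ?r" "(6,10) \<in> ?r"
    by (simp_all add: adj_on_def G10_iff)
  have "(1, j) \<in> ?r\<^sup>*" if "j \<in> {1..10}" for j
    using that edges unfolding atLeastAtMost_1_10
    by (elim insertE emptyE) (meson rtrancl.intros)+
  moreover have "?r `` {1..10} \<subseteq> {1..10}"
    by (auto simp: adj_on_def)
  ultimately have "?r\<^sup>* `` {i} = {1..10}" if "i \<in> {1..10}" for i
    using that by (intro rtrancl_Image_eq sym_adj_on) auto
  then have "\<forall>i\<in>{1..10}. \<forall>j\<in>{1..10}. (i, j) \<in> ?r\<^sup>*"
    by blast
  moreover have "G10 \<subseteq> {e. e \<subseteq> {1..10} \<and> card e = 2}"
    by (auto simp: G10_def)
  ultimately show ?thesis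
    by (simp add: connected_simple_graph_def)
qed

definition phi :: "nat \<Rightarrow> real" where
  "phi = (\<lambda>i. if i \<in> {1..4} then - (1/28) else if i \<in> {5..10} then 1/28 else 0)"

text \<open>
  On the edges inside a nodal domain \<open>z\<close> is \<open>w i - w j\<close> with \<open>w\<close> below; the remaining two edges have
  \<open>z = \<plusminus>1\<close>.
\<close>

lemma eigenvector1_phi: "eigenvector1 10 G10 (1/7) phi"
proof -
  \<comment> \<open>The potential balances the two crossing edges: inside the domains the sums of
    \<open>z\<close> must be 3/7 at 1 and 3, -3/7 at 2 and 4, -4/7 at 5 and 6, and 2/7 at the
    remaining vertices. All differences of \<open>w\<close> lie in [-1,1].\<close>
  define w :: "nat \<Rightarrow> real" where
    "w i = (if i \<in> {1, 3} then 3/14 else if i \<in> {7, 8, 9, 10} then 2/7 else 0)" for i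
  define z :: "nat \<Rightarrow> nat \<Rightarrow> real" where
    "z i j = (if i \<le> 4 \<and> 5 \<le> j then -1 else if j \<le> 4 \<and> 5 \<le> i then 1 else w i - w j)" for i j
  have "\<forall>i j. {i, j} \<in> G10 \<longrightarrow> z i j \<in> Sgn (phi i - phi j) \<and> z j i = - z i j"
    unfolding G10_iff
    by (intro allI impI, elim insertE emptyE; simp add: z_def w_def phi_def Sgn_def)
  moreover have "\<forall>i\<in>{1..10}. (\<Sum>j\<in>nbrs G10 i. z i j) = 1/7 * real (deg G10 i) * sgn (phi i)"
    unfolding atLeastAtMost_1_10
    by (simp add: nbrs_G10[simplified] deg_def z_def w_def phi_def)
  moreover have "sgn (phi i) \<in> Sgn (phi i)" for i
    by (auto simp: Sgn_def)
  moreover have "phi \<in> Rvec 10"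
    by (auto simp: Rvec_def phi_def)
  moreover have "phi 1 \<noteq> 0"
    by (simp add: phi_def)
  then have "phi \<noteq> (\<lambda>i. 0)"
    by metis
  ultimately show ?thesis
    unfolding eigenvector1_def by blast
qed

lemma W_phi: "W 10 G10 phi = 3"
proof -
  have pos: "{i \<in> {1..10}. phi i \<ge> 0} = {5,7,8} \<union> {6,9,10}"
    unfolding atLeastAtMost_1_10 by (auto simp: phi_def)
  have neg: "{i \<in> {1..10}. phi i \<le> 0} = {1,2,3,4}"
    unfolding atLeastAtMost_1_10 by (auto simp: phi_def)
  let ?p = "adj_on G10 ({5,7,8} \<union> {6,9,10})" and ?n = "adj_on G10 {1,2,3,4}"
  \<comment> \<open>The two triangles are linked only through negative vertices. The roots 5, 6 and
    1 are each adjacent to the rest of their domain, so single edges suffice as paths.\<close>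
  have 1: "?p\<^sup>* `` {i} = {5,7,8}" if "i \<in> {5,7,8}" for i
  proof (rule rtrancl_Image_eq[OF sym_adj_on _ _ that])
    show "?p `` {5,7,8} \<subseteq> {5,7,8}"
      by (auto simp: adj_on_iff_nbrs nbrs_G10[simplified])
    show "(5, j) \<in> ?p\<^sup>*" if "j \<in> {5,7,8}" for j
      using that by (elim insertE emptyE; simp add: r_into_rtrancl adj_on_iff_nbrs nbrs_G10[simplified])
  qed
  have 2: "?p\<^sup>* `` {i} = {6,9,10}" if "i \<in> {6,9,10}" for i
  proof (rule rtrancl_Image_eq[OF sym_adj_on _ _ that])
    show "?p `` {6,9,10} \<subseteq> {6,9,10}"
      by (auto simp: adj_on_iff_nbrs nbrs_G10[simplified])
    show "(6, j) \<in> ?p\<^sup>*" if "j \<in> {6,9,10}" for j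
      using that by (elim insertE emptyE; simp add: r_into_rtrancl adj_on_iff_nbrs nbrs_G10[simplified])
  qed
  have 3: "?n\<^sup>* `` {i} = {1,2,3,4}" if "i \<in> {1,2,3,4}" for i
  proof (rule rtrancl_Image_eq[OF sym_adj_on _ _ that])
    show "?n `` {1,2,3,4} \<subseteq> {1,2,3,4}"
      by (auto simp: adj_on_def)
    show "(1, j) \<in> ?n\<^sup>*" if "j \<in> {1,2,3,4}" for j
      using that by (elim insertE emptyE; simp add: r_into_rtrancl adj_on_iff_nbrs nbrs_G10[simplified])
  qed
  have "graph_components G10 ({5,7,8} \<union> {6,9,10}) = {{5,7,8}, {6,9,10}}"
    unfolding graph_components_def quotient_def using 1 2 by simp
  then have "pos_weak_domains 10 G10 phi = {{5,7,8}, {6,9,10}}"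
    unfolding pos_weak_domains_def pos by (auto simp: phi_def)
  moreover have "graph_components G10 {1,2,3,4} = {{1,2,3,4}}"
    unfolding graph_components_def quotient_def using 3 by simp
  then have "neg_weak_domains 10 G10 phi = {{1,2,3,4}}"
    unfolding neg_weak_domains_def neg by (auto simp: phi_def)
  moreover have "{5,7,8} \<noteq> {6,9,10::nat}"
    by auto
  ultimately show ?thesis
    by (simp add: W_def)
qed

theorem mainTheorem7:
  fixes E :: "nat set set" and \<phi> :: "nat \<Rightarrow> real"
  assumes E: "E = {{1,2}, {1,3}, {1,4}, {1,5}, {2,3}, {2,4}, {3,4}, {3,6}, {5,7}, {5,8},
                   {7,8}, {6,9}, {6,10}, {9,10}}"
    and \<phi>: "\<phi> = (\<lambda>i. if i \<in> {1..4} then - (1/28) else if i \<in> {5..10} then 1/28 else 0)"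
  shows "connected_simple_graph 10 E \<and>
    minimax 10 E 2 = 1/7 \<and>
    eigenvector1 10 E (minimax 10 E 2) \<phi> \<and>
    W 10 E \<phi> = 3 \<and>
    \<not> (\<forall>n F k x. connected_simple_graph n F \<longrightarrow> 1 \<le> k \<longrightarrow> k \<le> n \<longrightarrow>
          eigenvector1 n F (minimax n F k) x \<longrightarrow> W n F x \<le> k)"
proof -
  have eqs: "E = G10" "\<phi> = phi"
    using E \<phi> by (simp_all only: G10_def phi_def)
  have main: "connected_simple_graph 10 E" "minimax 10 E 2 = 1/7"
      "eigenvector1 10 E (minimax 10 E 2) \<phi>" "W 10 E \<phi> = 3"
    unfolding eqs minimax_G10 by (rule connected_G10 refl eigenvector1_phi W_phi)+
  have "\<not> (\<forall>n F k x. connected_simple_graph n F \<longrightarrow> 1 \<le> k \<longrightarrow> k \<le> n \<longrightarrow>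
          eigenvector1 n F (minimax n F k) x \<longrightarrow> W n F x \<le> k)"
  proof
    assume "\<forall>n F k x. connected_simple_graph n F \<longrightarrow> 1 \<le> k \<longrightarrow> k \<le> n \<longrightarrow>
          eigenvector1 n F (minimax n F k) x \<longrightarrow> W n F x \<le> k"
    \<comment> \<open>The instance \<open>n = 10\<close>, \<open>k = 2\<close> would give 3 \<le>
      2.\<close>
    from this[rule_format, OF main(1) _ _ main(3)] main(4) show False
      by simp
  qed
  with main show ?thesis
    by blast
qed

end
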